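(* Let $\lambda\in[0,1)$, let $K$ be a coagulation kernel for which there are $k_2>k_1>0$ such that $$k_1\left(x^\lambda+y^\lambda\right)\le K(x,y)\le k_2\left(x^\lambda+y^\lambda\right),\qquad (x,y)\in(0,\infty)^2,$$ let $S\in X_0^+$, and let $\varphi$ be a stationary solution to the coagulation equation with source $S$. If $S\not\equiv 0$, then $\varphi\notin X_{(1+\lambda)/2}$.
   Context: For $m\in\mathbb{R}$, $X_m:=L^1((0,\infty),x^m\,\mathrm{d}x)$, $X_{0,m}:=X_0\cap X_m$, and $X_m^+$, $X_{0,m}^+$ denote their positive cones (functions non-negative almost everywhere). A coagulation kernel is a measurable, non-negative and symmetric function $K$ on $(0,\infty)^2$, i.e. $K(x,y)=K(y,x)\ge 0$. The coagulation equation with source is $\partial_t f=\mathcal{C}f+S$ on $(0,\infty)^2$, where $\mathcal{C}f(x)=\frac12\int_0^x K(y,x-y)f(y)f(x-y)\,\mathrm{d}y-\int_0^\infty K(x,y)f(x)f(y)\,\mathrm{d}y$. A stationary solution to it (with source $S\in X_0^+$ and kernel $K$ satisfying, for some $\lambda\ge 0$ and $k_2>k_1>0$, the two-sided bound $k_1\left(x^\lambda+y^\lambda\right)\le K(x,y)\le k_2\left(x^\lambda+y^\lambda\right)$ for all $(x,y)\in(0,\infty)^2$) is a function $\varphi\in X_{0,\lambda}^+$ such that $$\frac12\int_0^\infty\int_0^\infty \chi_\vartheta(x,y)K(x,y)\varphi(x)\varphi(y)\,\mathrm{d}y\,\mathrm{d}x+\int_0^\infty S(x)\vartheta(x)\,\mathrm{d}x=0$$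 for all $\vartheta\in L^\infty(0,\infty)$, where $\chi_\vartheta(x,y):=\vartheta(x+y)-\vartheta(x)-\vartheta(y)$ for $(x,y)\in(0,\infty)^2$. *)

theory Defs
  imports "HOL-Analysis.Analysis"
begin

text \<open>
  Elements of \<open>L\<^sup>1\<close> and \<open>L\<^sup>\<infinity>\<close> are represented by Lebesgue measurable functions on \<open>real\<close>, of
  which only the values on \<open>(0,\<infinity>)\<close> matter; identification up to null sets is expressed by
  \<open>AE\<close> statements with respect to the following measure.
\<close>

abbreviation half_line :: "real measure" where
  "half_line \<equiv> lebesgue_on {0<..}"

definition X :: "real \<Rightarrow> (real \<Rightarrow> real) set" where
  "X m = {f. integrable (density half_line (\<lambda>x. ennreal (x powr m))) f}"

definition X0 :: "real \<Rightarrow> (real \<Rightarrow> real) set" where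
  "X0 m = X 0 \<inter> X m"

definition pos_cone :: "(real \<Rightarrow> real) set \<Rightarrow> (real \<Rightarrow> real) set" where
  "pos_cone F = {f \<in> F. AE x in half_line. 0 \<le> f x}"

definition L_infty :: "(real \<Rightarrow> real) set" where
  "L_infty = {\<theta>. \<theta> \<in> borel_measurable half_line \<and> (\<exists>C. AE x in half_line. \<bar>\<theta> x\<bar> \<le> C)}"

definition coagulation_kernel :: "(real \<Rightarrow> real \<Rightarrow> real) \<Rightarrow> bool" where
  "coagulation_kernel K \<longleftrightarrow>
     (\<lambda>(x, y). K x y) \<in> borel_measurable (lebesgue_on ({0<..} \<times> {0<..})) \<and>
     (\<forall>x>0. \<forall>y>0. K x y = K y x \<and> 0 \<le> K x y)"

definition chi :: "(real \<Rightarrow> real) \<Rightarrow> real \<Rightarrow> real \<Rightarrow> real" where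
  "chi \<theta> x y = \<theta> (x + y) - \<theta> x - \<theta> y"

text \<open>
  The exponent \<open>l\<close> is that of the bound \<open>K x y \<le> k2 * (x powr l + y powr l)\<close> on the kernel.
  Under this bound, and for \<open>S \<in> X 0\<close>, all integrals below converge absolutely, so that the
  convention giving the value 0 to the integral of a non-integrable function plays no role
  (except on a null set of \<open>x\<close>, where the inner integrand may fail to be measurable).
\<close>

definition stationary_solution ::
    "real \<Rightarrow> (real \<Rightarrow> real \<Rightarrow> real) \<Rightarrow> (real \<Rightarrow> real) \<Rightarrow> (real \<Rightarrow> real) \<Rightarrow> bool" where
  "stationary_solution l K S \<phi> \<longleftrightarrow>
     \<phi> \<in> pos_cone (X0 l) \<and>
     (\<forall>\<theta>\<in>L_infty.
        1 / 2 * (\<integral>x. (\<integral>y. chi \<theta> x y * K x y * \<phi> x * \<phi> y \<partial>half_line) \<partial>half_line)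
          + (\<integral>x. S x * \<theta> x \<partial>half_line) = 0)"

end

theory Submission
  imports Defs
begin

text \<open>
  Test the equation with \<open>\<theta> = min x A\<close>. Then \<open>chi \<theta> x y\<close> vanishes for \<open>x + y \<le> A\<close> and is at most
  \<open>min x y\<close> in absolute value, so with \<open>m = (1 + l) / 2\<close> the upper bound on the kernel gives
  \<open>\<bar>chi \<theta> x y * K x y\<bar> \<le> 2 * k2 * x powr m * y powr m\<close>, because \<open>1 + l = 2 * m\<close> and \<open>m \<le> 1\<close>. If \<open>\<phi>\<close> had a finite
  moment of order \<open>m\<close>, the coagulation term would thus be bounded by tails of this moment and would
  vanish as \<open>A \<longlongrightarrow> \<infinity>\<close>, whereas the integral of \<open>S x * min x A\<close> is non-decreasing in \<open>A\<close>.
\<close>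

text \<open>
  A non-integrable \<open>f\<close> has integral 0, so iterated integrals can be bounded without showing that the
  inner integral is a measurable function of the outer variable.
\<close>

lemma abs_integral_le:
  fixes f g :: "'a \<Rightarrow> real"
  assumes "integrable M g" and "AE x in M. \<bar>f x\<bar> \<le> g x"
  shows "\<bar>\<integral>x. f x \<partial>M\<bar> \<le> (\<integral>x. g x \<partial>M)"
proof (cases "integrable M f")
  case True
  have "\<bar>\<integral>x. f x \<partial>M\<bar> \<le> (\<integral>x. \<bar>f x\<bar> \<partial>M)"
    by (rule integral_abs_bound)
  also have "\<dots> \<le> (\<integral>x. g x \<partial>M)"
    using True assms by (intro integral_mono_AE) auto
  finally show ?thesis .
next
  case False
  have "AE x in M. 0 \<le> g x"
    using assms(2) by eventually_elim linarith
  then have "0 \<le> (\<integral>x. g x \<partial>M)"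
    by (rule integral_nonneg_AE)
  with False show ?thesis
    by (simp add: not_integrable_integral_eq)
qed

lemma borel_measurable_half_line:
  assumes "f \<in> borel_measurable borel"
  shows "f \<in> borel_measurable half_line"
proof -
  have "f \<in> borel_measurable lebesgue"
    using assms by (intro measurable_completion) simp
  then show ?thesis
    by (rule measurable_restrict_space1)
qed

lemma AE_half_line_pos: "AE x in half_line. 0 < x"
  by (rule AE_I2) (simp add: space_restrict_space)

text \<open>Moves the weight from the measure into the integrand. \<open>density\<close> leaves the
  sigma-algebra unchanged, so measurability over \<open>half_line\<close> is already part of
  membership in \<open>X m\<close>.\<close>

lemma X_iff:
  "f \<in> X m \<longleftrightarrow> f \<in> borel_measurable half_line \<and> integrable half_line (\<lambda>x. x powr m * f x)"
proof -
  have "f \<in> borel_measurable half_line" if "f \<in> X m"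
    using that unfolding X_def by (auto dest: borel_measurable_integrable)
  moreover have "f \<in> X m \<longleftrightarrow> integrable half_line (\<lambda>x. x powr m * f x)"
    if "f \<in> borel_measurable half_line"
    unfolding X_def mem_Collect_eq using that
    by (intro integrable_real_density borel_measurable_half_line[of "\<lambda>x. x powr m"]) auto
  ultimately show ?thesis
    by blast
qed

lemma X_0_integrable:
  assumes "f \<in> X 0"
  shows "integrable half_line f"
proof -
  have "integrable half_line (\<lambda>x. x powr 0 * f x)"
    using assms unfolding X_iff by (rule conjunct2)
  \<comment> \<open>\<open>0 powr 0\<close> is 0, so the weight equals 1 only away from the origin;
    the congruence is used on positive \<open>x\<close> alone.\<close>
  also have "?this \<longleftrightarrow> ?thesis"
    by (rule Bochner_Integration.integrable_cong) (auto simp: space_restrict_space)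
  finally show ?thesis .
qed

lemma min_in_L_infty:
  assumes "0 \<le> A"
  shows "(\<lambda>x. min x A) \<in> L_infty"
proof -
  have "AE x in half_line. \<bar>min x A\<bar> \<le> A"
    using AE_half_line_pos by eventually_elim (use assms in auto)
  moreover have "(\<lambda>x. min x A) \<in> borel_measurable half_line"
    by (intro borel_measurable_half_line) measurable
  ultimately show ?thesis
    unfolding L_infty_def by blast
qed

text \<open>Subadditivity of the truncation gives \<open>chi \<le> 0\<close>, and its monotonicity
  gives \<open>chi \<ge> - min x y\<close>. If neither variable exceeds \<open>A / 2\<close>, then
  \<open>x + y \<le> A\<close> and \<open>chi\<close> vanishes. Replacing the condition
  \<open>x + y > A\<close> by conditions on single variables lets the double integral factor
  later.\<close>

lemma abs_chi_min:
  assumes "0 < x" "0 < y" "0 \<le> A"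
  shows "\<bar>chi (\<lambda>x. min x A) x y\<bar>
    \<le> min x y * (indicator {A / 2<..} x + indicator {A / 2<..} y)"
  using assms by (auto simp: chi_def min_def indicator_def)

text \<open>For \<open>x \<le> y\<close> both powers are at most \<open>y powr l\<close>. Split
  \<open>x\<close> as \<open>x powr ((1 + l) / 2) * x powr ((1 - l) / 2)\<close> and enlarge the
  base of the second factor to \<open>y\<close>, which \<open>l \<le> 1\<close> allows; the
  exponents on \<open>y\<close> then add up to \<open>(1 + l) / 2\<close>.\<close>

lemma min_mult_powr_add_le:
  fixes x y l :: real
  assumes "0 < x" "0 < y" "0 \<le> l" "l \<le> 1"
  shows "min x y * (x powr l + y powr l) \<le> 2 * (x powr ((1 + l) / 2) * y powr ((1 + l) / 2))"
  using assms(1,2)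
proof (induction x y rule: linorder_wlog)
  case (le x y)
  have "x * (x powr l + y powr l) \<le> x * (2 * y powr l)"
    using le assms(3) by (intro mult_left_mono) (auto simp: powr_mono2)
  also have "\<dots> = 2 * (x powr ((1 + l) / 2) * x powr ((1 - l) / 2) * y powr l)"
    using le by (simp flip: powr_add add_divide_distrib)
  also have "\<dots> \<le> 2 * (x powr ((1 + l) / 2) * y powr ((1 - l) / 2) * y powr l)"
    using le assms by (intro mult_left_mono mult_right_mono powr_mono2) auto
  also have "\<dots> = 2 * (x powr ((1 + l) / 2) * (y powr ((1 - l) / 2 + l)))"
    by (simp only: powr_add mult.assoc)
  also have "(1 - l) / 2 + l = (1 + l) / 2"
    by (simp add: field_simps)
  finally show ?case
    using le by (simp add: min_def)
next
  case (sym x y)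
  then show ?case
    by (simp add: min.commute mult.commute add.commute)
qed

text \<open>Dominated convergence: at each point the cutoff is eventually zero. The threshold
  \<open>n / 2\<close> is the one from \<open>abs_chi_min\<close> with \<open>A = n\<close>.\<close>

lemma integral_tail_tendsto_0:
  fixes f :: "real \<Rightarrow> real"
  assumes "integrable half_line f"
  shows "(\<lambda>n. \<integral>x. f x * indicator {real n / 2<..} x \<partial>half_line) \<longlonglongrightarrow> 0"
proof -
  have lim: "(\<lambda>n. f x * indicator {real n / 2<..} x) \<longlonglongrightarrow> 0" for x
  proof (rule tendsto_eventually)
    show "\<forall>\<^sub>F n in sequentially. f x * indicator {real n / 2<..} x = 0"
      using eventually_ge_at_top[of "nat \<lceil>2 * x\<rceil>"]
    proof eventually_elim
      case (elim n)
      then have "2 * x \<le> real n"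
        by linarith
      then show ?case
        by (simp add: indicator_def)
    qed
  qed
  have "(\<lambda>n. \<integral>x. f x * indicator {real n / 2<..} x \<partial>half_line)
      \<longlonglongrightarrow> (\<integral>x. 0 \<partial>half_line)"
  proof (rule integral_dominated_convergence[where w = "\<lambda>x. \<bar>f x\<bar>"])
    show "(\<lambda>x. f x * indicator {real n / 2<..} x) \<in> borel_measurable half_line" for n
      using assms by (intro borel_measurable_times borel_measurable_half_line[of "indicator _"]) auto
  qed (use assms lim in \<open>auto simp: indicator_def\<close>)
  then show ?thesis
    by simp
qed

theorem proposition2p1:
  fixes l k1 k2 :: real
    and K :: "real \<Rightarrow> real \<Rightarrow> real"
    and S \<phi> :: "real \<Rightarrow> real"
  assumes "0 \<le> l" and "l < 1"
    and "coagulation_kernel K"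
    and "0 < k1" and "k1 < k2"
    and "\<And>x y. 0 < x \<Longrightarrow> 0 < y \<Longrightarrow>
           k1 * (x powr l + y powr l) \<le> K x y \<and> K x y \<le> k2 * (x powr l + y powr l)"
    and "S \<in> pos_cone (X 0)"
    and "stationary_solution l K S \<phi>"
    and "\<not> (AE x in half_line. S x = 0)"
  shows "\<phi> \<notin> X ((1 + l) / 2)"
proof
  assume "\<phi> \<in> X ((1 + l) / 2)"
  define m where "m = (1 + l) / 2"
  \<comment> \<open>The absolute value makes the bounds below hold at every positive point, although
    \<open>\<phi>\<close> is non-negative only almost everywhere.\<close>
  define \<psi> where "\<psi> x = \<bar>x powr m * \<phi> x\<bar>" for x
  define \<psi>' where "\<psi>' A x = \<psi> x * indicator {A / 2<..} x" for A x :: real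
  define T where "T A = (\<integral>x. \<psi>' A x \<partial>half_line)" for A
  define M where "M = (\<integral>x. \<psi> x \<partial>half_line)"
  have \<psi>: "integrable half_line \<psi>"
    using \<open>\<phi> \<in> X ((1 + l) / 2)\<close> unfolding \<psi>_def m_def X_iff by (intro integrable_abs) auto
  have \<psi>': "integrable half_line (\<psi>' A)" for A
  proof (rule Bochner_Integration.integrable_bound[OF \<psi>])
    show "\<psi>' A \<in> borel_measurable half_line"
      unfolding \<psi>'_def using \<psi>
      by (intro borel_measurable_times borel_measurable_half_line[of "indicator _"]) auto
  qed (auto simp: \<psi>'_def indicator_def)

  have integrand: "\<bar>chi (\<lambda>x. min x A) x y * K x y * \<phi> x * \<phi> y\<bar>
      \<le> 2 * k2 * (\<psi>' A x * \<psi> y + \<psi> x * \<psi>' A y)"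
    if "0 < x" "0 < y" "0 \<le> A" for x y A
  proof -
    let ?i = "indicator {A / 2<..} x + indicator {A / 2<..} y :: real"
    have "0 \<le> K x y" "K x y \<le> k2 * (x powr l + y powr l)"
      using assms(3,6) that by (auto simp: coagulation_kernel_def)
    then have "\<bar>chi (\<lambda>x. min x A) x y * K x y\<bar> \<le> min x y * ?i * (k2 * (x powr l + y powr l))"
      unfolding abs_mult using abs_chi_min[OF that] that by (intro mult_mono) auto
    also have "\<dots> = k2 * ?i * (min x y * (x powr l + y powr l))"
      by (simp add: mult_ac)
    also have "\<dots> \<le> k2 * ?i * (2 * (x powr m * y powr m))"
      unfolding m_def using min_mult_powr_add_le[of x y l] that assms(1,2,4,5)
      by (intro mult_left_mono) auto
    finally have "\<bar>chi (\<lambda>x. min x A) x y * K x y\<bar> * \<bar>\<phi> x * \<phi> y\<bar>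
        \<le> k2 * ?i * (2 * (x powr m * y powr m)) * \<bar>\<phi> x * \<phi> y\<bar>"
      by (rule mult_right_mono) simp
    then show ?thesis
      by (simp add: \<psi>_def \<psi>'_def abs_mult algebra_simps)
  qed

  \<comment> \<open>Each of the two products in \<open>integrand\<close> separates and integrates to
    \<open>M * T A\<close>, whence the factor 4.\<close>
  have coag: "\<bar>\<integral>x. (\<integral>y. chi (\<lambda>x. min x A) x y * K x y * \<phi> x * \<phi> y \<partial>half_line) \<partial>half_line\<bar>
      \<le> 4 * k2 * M * T A" if "0 \<le> A" for A
  proof -
    have "\<bar>\<integral>y. chi (\<lambda>x. min x A) x y * K x y * \<phi> x * \<phi> y \<partial>half_line\<bar>
        \<le> 2 * k2 * (\<psi>' A x * M + \<psi> x * T A)" if "0 < x" for x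
    proof -
      have "\<bar>\<integral>y. chi (\<lambda>x. min x A) x y * K x y * \<phi> x * \<phi> y \<partial>half_line\<bar>
          \<le> (\<integral>y. 2 * k2 * (\<psi>' A x * \<psi> y + \<psi> x * \<psi>' A y) \<partial>half_line)"
      proof (rule abs_integral_le)
        show "AE y in half_line. \<bar>chi (\<lambda>x. min x A) x y * K x y * \<phi> x * \<phi> y\<bar>
            \<le> 2 * k2 * (\<psi>' A x * \<psi> y + \<psi> x * \<psi>' A y)"
          using AE_half_line_pos by eventually_elim (rule integrand[OF that _ \<open>0 \<le> A\<close>])
      qed (use \<psi> \<psi>' in auto)
      also have "\<dots> = 2 * k2 * (\<psi>' A x * M + \<psi> x * T A)"
        using \<psi> \<psi>' by (simp add: M_def T_def)
      finally show ?thesis .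
    qed
    then have "\<bar>\<integral>x. (\<integral>y. chi (\<lambda>x. min x A) x y * K x y * \<phi> x * \<phi> y \<partial>half_line) \<partial>half_line\<bar>
        \<le> (\<integral>x. 2 * k2 * (\<psi>' A x * M + \<psi> x * T A) \<partial>half_line)"
      using \<psi> \<psi>' by (intro abs_integral_le eventually_mono[OF AE_half_line_pos]) auto
    also have "\<dots> = 4 * k2 * M * T A"
      using \<psi> \<psi>' by (simp add: M_def T_def)
    finally show ?thesis .
  qed

  have S: "integrable half_line S" "AE x in half_line. 0 \<le> S x"
    using assms(7) X_0_integrable by (auto simp: pos_cone_def)
  have S_min: "integrable half_line (\<lambda>x. S x * min x A)" if "0 \<le> A" for A
  proof (rule Bochner_Integration.integrable_bound)
    show "integrable half_line (\<lambda>x. A * S x)"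
      using S by simp
    show "(\<lambda>x. S x * min x A) \<in> borel_measurable half_line"
      using S by (intro borel_measurable_times borel_measurable_half_line[of "\<lambda>x. min x A"]) auto
    show "AE x in half_line. norm (S x * min x A) \<le> norm (A * S x)"
      using AE_half_line_pos
    proof eventually_elim
      case (elim x)
      then have "\<bar>S x\<bar> * \<bar>min x A\<bar> \<le> \<bar>S x\<bar> * A"
        using that by (intro mult_left_mono) auto
      then show ?case
        using that by (simp add: abs_mult mult.commute)
    qed
  qed
  \<comment> \<open>The left side does not depend on \<open>n\<close>, so a vanishing right side
    forces it to be non-positive. The factor 1/2 in the weak formulation turns the 4 of
    \<open>coag\<close> into 2.\<close>
  have source: "(\<integral>x. S x * min x 1 \<partial>half_line) \<le> 2 * k2 * M * T (real n)" if "1 \<le> n" for n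
  proof -
    have "(\<integral>x. S x * min x 1 \<partial>half_line) \<le> (\<integral>x. S x * min x (real n) \<partial>half_line)"
    proof (rule integral_mono_AE)
      show "AE x in half_line. S x * min x 1 \<le> S x * min x (real n)"
        using S(2) by eventually_elim (use that in \<open>auto intro!: mult_left_mono\<close>)
    qed (use S_min in auto)
    also have "\<dots> \<le> 2 * k2 * M * T (real n)"
    proof -
      have "1 / 2 * (\<integral>x. (\<integral>y. chi (\<lambda>x. min x (real n)) x y * K x y * \<phi> x * \<phi> y
          \<partial>half_line) \<partial>half_line) + (\<integral>x. S x * min x (real n) \<partial>half_line) = 0"
        using assms(8) min_in_L_infty[of "real n"] unfolding stationary_solution_def by auto
      with coag[of "real n"] show ?thesis
        by linarith
    qed
    finally show ?thesis .
  qed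
  have "(\<lambda>n. T (real n)) \<longlonglongrightarrow> 0"
    unfolding T_def \<psi>'_def using \<psi> by (rule integral_tail_tendsto_0)
  then have "(\<lambda>n. 2 * k2 * M * T (real n)) \<longlonglongrightarrow> 0"
    by (rule tendsto_mult_right_zero)
  then have "(\<integral>x. S x * min x 1 \<partial>half_line) \<le> 0"
    using source by (intro LIMSEQ_le_const) auto
  moreover have nonneg: "AE x in half_line. 0 \<le> S x * min x 1"
    using S(2) AE_half_line_pos by eventually_elim auto
  ultimately have "(\<integral>x. S x * min x 1 \<partial>half_line) = 0"
    using integral_nonneg_AE[OF nonneg] by linarith
  then have "AE x in half_line. S x * min x 1 = 0"
    using integral_nonneg_eq_0_iff_AE[OF S_min[of 1] nonneg] by simp
  \<comment> \<open>The factor \<open>min x 1\<close> is positive for \<open>x > 0\<close>, so it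
    can be cancelled.\<close>
  then have "AE x in half_line. S x = 0"
    using AE_half_line_pos by eventually_elim (auto simp: min_def split: if_splits)
  with assms(9) show False
    by contradiction
qed

end
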